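(* Let $T$ be an $n$-vertex tournament with $\delta^0(T)\geq \lfloor \frac{n+2}{4}\rfloor$. Then, for a uniformly random subset $S\subseteq V(T)$, we have $\mathbb{P}[T[S]\text{ is Hamiltonian}]\geq \frac12-o(1)$. That is, there is a function $f:\mathbb{N}\to\mathbb{R}$ with $f(n)\to 0$ as $n\to\infty$ such that for every $n$ and every $n$-vertex tournament $T$ with $\delta^0(T)\geq \lfloor \frac{n+2}{4}\rfloor$ the probability $\mathbb{P}[T[S]\text{ is Hamiltonian}]$, where $S\subseteq V(T)$ is a uniformly random subset, is at least $\frac12-f(n)$.
   Context: A tournament is a directed graph in which every pair of distinct vertices is joined by exactly one directed edge. $d^+(v)$ and $d^-(v)$ denote the numbers of outgoing and incoming edges at $v$. The minimum semidegree $\delta^0(T)$ is the largest number $\delta$ such that $d^+(v),d^-(v)\geq\delta$ for all $v\in V(T)$. $T[S]$ is the subtournament induced on the vertex set $S$. A tournament is Hamiltonian if it contains a directed cycle visiting every vertex. The term $o(1)$ denotes a quantity depending only on $n$ (and not on the particular tournament) which tends to $0$ as $n\to\infty$. *)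

theory Defs
  imports
    "HOL-Probability.Probability_Mass_Function"
    "Graph_Theory.Arc_Walk"
    "Graph_Theory.Digraph_Component"
begin

locale tournament = digraph +
  assumes ex1_arc:
    "\<lbrakk>u \<in> verts G; v \<in> verts G; u \<noteq> v\<rbrakk> \<Longrightarrow> \<exists>!e. e \<in> arcs G \<and> {tail G e, head G e} = {u, v}"

(* For a digraph without vertices there is no largest such number and the value is unspecified. *)
definition min_semidegree :: "('a, 'b) pre_digraph \<Rightarrow> nat" where
  "min_semidegree G = (GREATEST d. \<forall>v \<in> verts G. d \<le> out_degree G v \<and> d \<le> in_degree G v)"

(* The library's cycles are nonempty closed arc walks without repeated vertices (loops are allowed
   in general).  Since tournaments have neither loops nor 2-cycles, a tournament with fewer than
   three vertices is not Hamiltonian. *)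
definition hamiltonian :: "('a, 'b) pre_digraph \<Rightarrow> bool" where
  "hamiltonian G \<longleftrightarrow> (\<exists>p. pre_digraph.cycle G p \<and> (\<forall>v \<in> verts G. \<exists>e \<in> set p. tail G e = v))"

lemma (in fin_digraph) le_min_semidegree_iff:
  assumes "verts G \<noteq> {}"
  shows "k \<le> min_semidegree G \<longleftrightarrow> (\<forall>v \<in> verts G. k \<le> out_degree G v \<and> k \<le> in_degree G v)"
proof -
  let ?P = "\<lambda>d. \<forall>v \<in> verts G. d \<le> out_degree G v \<and> d \<le> in_degree G v"
  obtain w where w: "w \<in> verts G" using assms by blast
  have bound: "d \<le> out_degree G w" if "?P d" for d using that w by blast
  have "?P (min_semidegree G)"
    unfolding min_semidegree_def
    by (rule GreatestI_nat[where P = ?P and k = 0 and b = "out_degree G w"]) (use bound in auto)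
  moreover have "k \<le> min_semidegree G" if "?P k"
    unfolding min_semidegree_def
    by (rule Greatest_le_nat[where P = ?P and b = "out_degree G w"]) (use bound that in auto)
  ultimately show ?thesis by (meson le_trans)
qed

end

(* By Camion's theorem, T[S] with at least two vertices fails to be Hamiltonian only if S splits into
   nonempty X and Y with no arc from Y to X. A set P of at most k, roughly log n, vertices of X such that
   every other vertex of X has an arc into P determines X inside S, so only n^k cuts of V(T) need
   to be considered. For each cut, either the backward arcs contain M disjoint ones, and a random S
   avoids them all with probability at most (3/4)^M, or 2M vertices W cover all backward arcs; here
   M is about n^(1/3). In the second case, unless one side is tiny (and then the semidegree bound
   makes the cut unlikely), both sides have about n/2 vertices, and any two such cuts nearly
   coincide. The bound (n+2) div 4 is just enough to force linearly many backward arcs, so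
   some vertex w has many arcs backwards across the cut in both directions, and hence across
   each of these cuts. If w lies in S, then S respects such a cut with probability at most
   2^(-2M); and w is not in S with probability 1/2. *)

theory Submission
  imports Defs "HOL-Real_Asymp.Real_Asymp"
begin

subsection \<open>Cuts of subtournaments\<close>

locale fin_tournament =
  fixes V :: "'a set" and E :: "'a \<Rightarrow> 'a \<Rightarrow> bool"
  assumes finite_V: "finite V"
    and asym: "E x y \<Longrightarrow> \<not> E y x"
    and total: "x \<in> V \<Longrightarrow> y \<in> V \<Longrightarrow> x \<noteq> y \<Longrightarrow> E x y \<or> E y x"
begin

lemma irrefl: "\<not> E x x"
  using asym by blast

lemma fin_tournament_subset: "X \<subseteq> V \<Longrightarrow> fin_tournament X E"
  by unfold_locales (meson finite_V asym total rev_finite_subset subsetD)+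

lemma fin_tournament_converse: "fin_tournament V (\<lambda>x y. E y x)"
  using finite_V asym total by unfold_locales auto

lemma finite_sub: "X \<subseteq> V \<Longrightarrow> finite X"
  using finite_V by (rule rev_finite_subset)

section \<open>In-degree averages, and small sets into which all other vertices have an arc\<close>

lemma sum_in_degree: "2 * (\<Sum>x\<in>V. card {u\<in>V. E u x}) = card V * (card V - 1)"
proof -
  have split: "card {u\<in>V. E u x} + card {u\<in>V. E x u} = card V - 1" if "x \<in> V" for x
  proof -
    have "card {u\<in>V. E u x} + card {u\<in>V. E x u} = card ({u\<in>V. E u x} \<union> {u\<in>V. E x u})"
      using finite_V asym by (subst card_Un_disjoint) auto
    also have "{u\<in>V. E u x} \<union> {u\<in>V. E x u} = V - {x}"
      using that total irrefl by blast
    finally show ?thesis using that finite_V by simp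
  qed
  have swap: "(\<Sum>x\<in>V. card {u\<in>V. E u x}) = (\<Sum>x\<in>V. card {u\<in>V. E x u})"
  proof -
    have "(\<Sum>x\<in>V. card {u\<in>V. E u x}) = (\<Sum>x\<in>V. \<Sum>u\<in>V. if E u x then 1 else 0)"
      using finite_V by (simp add: sum.If_cases Int_def)
    also have "\<dots> = (\<Sum>u\<in>V. \<Sum>x\<in>V. if E u x then 1 else 0)" by (rule sum.swap)
    also have "\<dots> = (\<Sum>x\<in>V. card {u\<in>V. E x u})"
      using finite_V by (simp add: sum.If_cases Int_def)
    finally show ?thesis .
  qed
  have "2 * (\<Sum>x\<in>V. card {u\<in>V. E u x}) = (\<Sum>x\<in>V. card {u\<in>V. E u x} + card {u\<in>V. E x u})"
    using swap by (simp add: sum.distrib)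
  also have "\<dots> = card V * (card V - 1)" using split by simp
  finally show ?thesis .
qed

lemma ex_in_degree_le:
  assumes "V \<noteq> {}"
  shows "\<exists>x\<in>V. 2 * card {u\<in>V. E u x} \<le> card V - 1"
proof (rule ccontr)
  assume "\<not> ?thesis"
  then have "(\<Sum>x\<in>V. card V - 1) < (\<Sum>x\<in>V. 2 * card {u\<in>V. E u x})"
    using assms finite_V by (intro sum_strict_mono) (auto simp: not_le)
  then show False using sum_in_degree by (simp add: sum_distrib_left[symmetric])
qed

lemma ex_in_degree_ge:
  assumes "V \<noteq> {}"
  shows "\<exists>x\<in>V. card V - 1 \<le> 2 * card {u\<in>V. E u x}"
proof (rule ccontr)
  assume "\<not> ?thesis"
  then have "(\<Sum>x\<in>V. card V - 1) > (\<Sum>x\<in>V. 2 * card {u\<in>V. E u x})"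
    using assms finite_V by (intro sum_strict_mono) (auto simp: not_le)
  then show False using sum_in_degree by (simp add: sum_distrib_left[symmetric])
qed

text \<open>Greedy choice: some vertex receives arcs from at least half of the others. Once it and
  its in-neighbours are removed, less than half of the set is left, so \<open>k\<close> rounds
  suffice.\<close>

lemma ex_dominated_list:
  assumes "X \<subseteq> V" "X \<noteq> {}" "card X < 2 ^ k"
  shows "\<exists>ps. length ps = k \<and> set ps \<subseteq> X \<and> (\<forall>x\<in>X. \<exists>p\<in>set ps. x = p \<or> E x p)"
  using assms
proof (induction k arbitrary: X)
  case 0
  then show ?case using finite_sub by auto
next
  case (Suc k)
  interpret X: fin_tournament X E using Suc.prems(1) by (rule fin_tournament_subset)
  obtain x where x: "x \<in> X" "card X - 1 \<le> 2 * card {u\<in>X. E u x}"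
    using X.ex_in_degree_ge Suc.prems by blast
  let ?N = "insert x {u\<in>X. E u x}"
  let ?Y = "X - ?N"
  have "card ?N = Suc (card {u\<in>X. E u x})"
    using X.finite_V irrefl by (subst card_insert_disjoint) auto
  moreover have "card ?Y = card X - card ?N"
    using x X.finite_V by (intro card_Diff_subset) auto
  ultimately have cY: "card ?Y < 2 ^ k" using x(2) Suc.prems(3) by simp
  show ?case
  proof (cases "?Y = {}")
    case True
    then have "\<forall>y\<in>X. y = x \<or> E y x" by blast
    \<comment> \<open>Padding by repetition, since the length must be exactly
      \<open>Suc k\<close>.\<close>
    then show ?thesis using x(1) by (intro exI[of _ "replicate (Suc k) x"]) auto
  next
    case False
    obtain ps where ps: "length ps = k" "set ps \<subseteq> ?Y" "\<forall>y\<in>?Y. \<exists>p\<in>set ps. y = p \<or> E y p"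
      using Suc.IH[of ?Y] False cY Suc.prems(1) by blast
    have "\<exists>p\<in>set (x # ps). y = p \<or> E y p" if "y \<in> X" for y
    proof (cases "y \<in> ?Y")
      case True then show ?thesis using ps(3) by auto
    next
      case False then show ?thesis using that by auto
    qed
    then show ?thesis using ps(1,2) x(1) by (intro exI[of _ "x # ps"]) auto
  qed
qed

text \<open>\<open>A\<close> may reach outside \<open>S\<close>, so that one \<open>A\<close> serves
  many \<open>S\<close> and a union bound over few sets \<open>A\<close> becomes possible.\<close>

definition cut :: "'a set \<Rightarrow> 'a set \<Rightarrow> bool" where
  "cut S A \<longleftrightarrow> S \<inter> A \<noteq> {} \<and> S - A \<noteq> {} \<and> (\<forall>a\<in>S \<inter> A. \<forall>b\<in>S - A. \<not> E b a)"

text \<open>If every vertex of \<open>S \<inter> A\<close> lies in a small set \<open>P \<subseteq> S \<inter> A\<close> or has an arc into it, then \<open>P\<close>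
  determines \<open>S \<inter> A\<close> inside \<open>S\<close>.\<close>

lemma card_cut_sets_le:
  fixes c D :: nat
  assumes k: "card V < 2 ^ k"
    and D: "\<And>A. A \<subseteq> V \<Longrightarrow> c * card {S. S \<subseteq> V \<and> P S \<and> cut S A} \<le> D"
  shows "c * card {S. S \<subseteq> V \<and> P S \<and> (\<exists>A. cut S A)} \<le> card V ^ k * D"
proof -
  let ?L = "{ps. set ps \<subseteq> V \<and> length ps = k}"
  let ?A = "\<lambda>ps. {v\<in>V. \<exists>p\<in>set ps. v = p \<or> E v p}"
  have "{S. S \<subseteq> V \<and> P S \<and> (\<exists>A. cut S A)} \<subseteq> (\<Union>ps\<in>?L. {S. S \<subseteq> V \<and> P S \<and> cut S (?A ps)})"
  proof
    fix S assume "S \<in> {S. S \<subseteq> V \<and> P S \<and> (\<exists>A. cut S A)}"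
    then obtain A where S: "S \<subseteq> V" "P S" "cut S A" by blast
    have "card (S \<inter> A) < 2 ^ k"
      using S(1) finite_V k by (meson card_mono inf.coboundedI1 le_less_trans)
    then obtain ps where ps: "length ps = k" "set ps \<subseteq> S \<inter> A"
        "\<forall>x\<in>S \<inter> A. \<exists>p\<in>set ps. x = p \<or> E x p"
      using ex_dominated_list[of "S \<inter> A" k] S unfolding cut_def by blast
    \<comment> \<open>No arc leads from \<open>S - A\<close> into \<open>S \<inter> A\<close>, so
      \<open>?A ps\<close> picks up no vertex of \<open>S - A\<close>.\<close>
    have "S \<inter> ?A ps = S \<inter> A"
    proof (rule set_eqI)
      fix x
      have "x \<in> A" if "x \<in> S" "p \<in> set ps" "x = p \<or> E x p" for p
        using that ps(2) S(3) unfolding cut_def by blast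
      then show "x \<in> S \<inter> ?A ps \<longleftrightarrow> x \<in> S \<inter> A"
        using ps(3) S(1) by blast
    qed
    moreover from this have "S - ?A ps = S - A" by blast
    ultimately have "cut S (?A ps)" using S(3) unfolding cut_def by simp
    then show "S \<in> (\<Union>ps\<in>?L. {S. S \<subseteq> V \<and> P S \<and> cut S (?A ps)})"
      using S ps by blast
  qed
  then have "card {S. S \<subseteq> V \<and> P S \<and> (\<exists>A. cut S A)}
      \<le> card (\<Union>ps\<in>?L. {S. S \<subseteq> V \<and> P S \<and> cut S (?A ps)})"
    using finite_V by (intro card_mono finite_UN_I finite_lists_length_eq) auto
  also have "\<dots> \<le> (\<Sum>ps\<in>?L. card {S. S \<subseteq> V \<and> P S \<and> cut S (?A ps)})"
    using finite_V by (intro card_UN_le finite_lists_length_eq)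
  finally have "c * card {S. S \<subseteq> V \<and> P S \<and> (\<exists>A. cut S A)}
      \<le> c * (\<Sum>ps\<in>?L. card {S. S \<subseteq> V \<and> P S \<and> cut S (?A ps)})"
    by (rule mult_left_mono) simp
  also have "\<dots> \<le> (\<Sum>ps\<in>?L. D)"
    unfolding sum_distrib_left by (intro sum_mono D) auto
  also have "\<dots> = card V ^ k * D" using finite_V by (simp add: card_lists_length_eq)
  finally show ?thesis .
qed

end

text \<open>Disjoint pairs related by \<open>R\<close> are removed greedily. If this stops within
  \<open>M\<close> rounds, their ends form the cover. Otherwise an independent \<open>S\<close>
  contains at most one vertex of each of \<open>M\<close> removed pairs, which leaves 3 of 4
  possibilities per pair.\<close>

lemma cover_or_few_independent:
  assumes "finite V" and "\<And>x. \<not> R x x"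
  shows "(\<exists>W\<subseteq>V. card W \<le> 2 * M \<and> (\<forall>x\<in>V - W. \<forall>y\<in>V - W. \<not> R x y)) \<or>
    4 ^ M * card {S. S \<subseteq> V \<and> (\<forall>x\<in>S. \<forall>y\<in>S. \<not> R x y)} \<le> 3 ^ M * 2 ^ card V"
  using assms(1)
proof (induction M arbitrary: V)
  case 0
  have "card {S. S \<subseteq> V \<and> (\<forall>x\<in>S. \<forall>y\<in>S. \<not> R x y)} \<le> card (Pow V)"
    using 0 by (intro card_mono) auto
  then show ?case using 0 by (simp add: card_Pow)
next
  case (Suc M)
  show ?case
  proof (cases "\<forall>x\<in>V. \<forall>y\<in>V. \<not> R x y")
    case True
    then show ?thesis by (intro disjI1 exI[of _ "{}"]) auto
  next
    case False
    then obtain u v where uv: "u \<in> V" "v \<in> V" "R u v" by blast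
    then have "u \<noteq> v" using assms(2) by blast
    let ?V = "V - {u, v}"
    let ?I = "\<lambda>V. {S. S \<subseteq> V \<and> (\<forall>x\<in>S. \<forall>y\<in>S. \<not> R x y)}"
    have "card ?V + 2 = card V"
    proof -
      have "card ?V = card V - card {u, v}" using uv Suc.prems by (intro card_Diff_subset) auto
      moreover have "card {u, v} \<le> card V" using uv Suc.prems by (intro card_mono) auto
      ultimately show ?thesis using \<open>u \<noteq> v\<close> by simp
    qed
    then have "(2::nat) ^ card V = 2 ^ (card ?V + 2)" by simp
    then have cV: "(2::nat) ^ card V = 4 * 2 ^ card ?V" by (simp add: power_add)
    from Suc.IH[of ?V] Suc.prems consider
      W where "W \<subseteq> ?V" "card W \<le> 2 * M" "\<forall>x\<in>?V - W. \<forall>y\<in>?V - W. \<not> R x y"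
      | "4 ^ M * card (?I ?V) \<le> 3 ^ M * 2 ^ card ?V" by auto
    then show ?thesis
    proof cases
      case 1
      have "card (insert u (insert v W)) \<le> 2 * Suc M"
        proof -
        have "finite W" using 1(1) Suc.prems by (meson Diff_subset finite_subset)
        then show ?thesis using 1(2) by (simp add: card_insert_if)
      qed
      moreover have "\<forall>x\<in>V - insert u (insert v W). \<forall>y\<in>V - insert u (insert v W). \<not> R x y"
        using 1(3) by blast
      ultimately show ?thesis using 1(1) uv by (intro disjI1 exI[of _ "insert u (insert v W)"]) auto
    next
      case 2
      have "card (?I V) \<le> card ({{}, {u}, {v}} \<times> ?I ?V)"
      proof (rule card_inj_on_le[of "\<lambda>S. (S \<inter> {u, v}, S - {u, v})"])
        show "inj_on (\<lambda>S. (S \<inter> {u, v}, S - {u, v})) (?I V)"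
          by (rule inj_onI) (metis Int_Diff_Un prod.inject)
        show "(\<lambda>S. (S \<inter> {u, v}, S - {u, v})) ` ?I V \<subseteq> {{}, {u}, {v}} \<times> ?I ?V"
          using uv(3) by auto
        show "finite ({{}, {u}, {v}} \<times> ?I ?V)" using Suc.prems by auto
      qed
      also have "\<dots> \<le> 3 * card (?I ?V)"
        unfolding card_cartesian_product
        by (intro mult_right_mono order.trans[OF card_insert_le_m1]) (auto simp: card_insert_if)
      finally have "4 ^ Suc M * card (?I V) \<le> 12 * (4 ^ M * card (?I ?V))" by simp
      also have "\<dots> \<le> 12 * (3 ^ M * 2 ^ card ?V)" using 2 by simp
      finally show ?thesis using cV by simp
    qed
  qed
qed


subsection \<open>Tournaments with large minimum semidegree\<close>

text \<open>\<open>card_V_le\<close> captures the choice \<open>d = (n + 2) div 4\<close>, for which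
  \<open>4 * d \<ge> n - 1\<close>. By it, a set of at most half of the vertices has at most
  \<open>2 * d\<close> elements.\<close>

locale semidegree_tournament = fin_tournament +
  fixes d :: nat
  assumes in_degree_ge: "v \<in> V \<Longrightarrow> d \<le> card {u\<in>V. E u v}"
    and out_degree_ge: "v \<in> V \<Longrightarrow> d \<le> card {u\<in>V. E v u}"
    and card_V_le: "card V \<le> 4 * d + 1"
begin

text \<open>Reversal exchanges the two sides of a cut, so each bound for \<open>A\<close> yields one
  for \<open>V - A\<close>.\<close>

lemma semidegree_tournament_converse: "semidegree_tournament V (\<lambda>x y. E y x) d"
  using fin_tournament_converse in_degree_ge out_degree_ge card_V_le
  by (simp add: semidegree_tournament_def semidegree_tournament_axioms_def)

text \<open>Averaging gives a vertex of \<open>X\<close> with at most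
  \<open>(card X - 1) / 2\<close> in-neighbours in \<open>X\<close>; the others of its at least
  \<open>d\<close> in-neighbours lie in \<open>W\<close>.\<close>

lemma card_ge_of_in_closed:
  assumes "X \<subseteq> V" "X \<noteq> {}" "W \<subseteq> V"
    and "\<And>x u. x \<in> X \<Longrightarrow> u \<in> V \<Longrightarrow> E u x \<Longrightarrow> u \<in> X \<union> W"
  shows "2 * d + 1 \<le> card X + 2 * card W"
proof -
  interpret X: fin_tournament X E using assms(1) by (rule fin_tournament_subset)
  obtain x where x: "x \<in> X" "2 * card {u\<in>X. E u x} \<le> card X - 1"
    using X.ex_in_degree_le assms(2) by blast
  have "d \<le> card {u\<in>V. E u x}" using x(1) assms(1) in_degree_ge by blast
  also have "\<dots> \<le> card ({u\<in>X. E u x} \<union> W)"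
    using assms(4)[OF x(1)] finite_sub[OF assms(3)] X.finite_V by (intro card_mono) auto
  also have "\<dots> \<le> card {u\<in>X. E u x} + card W" by (rule card_Un_le)
  finally have "2 * d \<le> card X - 1 + 2 * card W" using x(2) by linarith
  moreover have "0 < card X" using assms(2) X.finite_V by (simp add: card_gt_0_iff)
  ultimately show ?thesis by linarith
qed

section \<open>Vertex covers of the backward arcs, which lead from \<open>V - A\<close> to
  \<open>A\<close>\<close>

definition back_cover :: "'a set \<Rightarrow> 'a set \<Rightarrow> bool" where
  "back_cover A W \<longleftrightarrow> W \<subseteq> V \<and> (\<forall>a\<in>A - W. \<forall>b\<in>V - A - W. \<not> E b a)"

lemma back_cover_converse:
  assumes "A \<subseteq> V" "back_cover A W"
  shows "semidegree_tournament.back_cover V (\<lambda>x y. E y x) (V - A) W"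
proof -
  interpret rev: semidegree_tournament V "\<lambda>x y. E y x" d
    by (rule semidegree_tournament_converse)
  show ?thesis using assms unfolding rev.back_cover_def back_cover_def by blast
qed

text \<open>All in-neighbours of \<open>A - W\<close> lie in \<open>A \<union> W\<close>. With the
  mirror image below, both sides of a cut with a small cover are tiny or at least nearly
  \<open>2 * d\<close>, about half of all vertices.\<close>

lemma back_cover_card_ge:
  assumes "A \<subseteq> V" "back_cover A W" "card W \<le> 2 * M" "2 * M < card A"
  shows "2 * d + 1 \<le> card (A - W) + 4 * M"
proof -
  have W: "W \<subseteq> V" using assms unfolding back_cover_def by blast
  have "A - W \<noteq> {}"
    using card_mono[OF finite_sub[OF W], of A] assms(3,4) by auto
  then have "2 * d + 1 \<le> card (A - W) + 2 * card W"
    using assms W unfolding back_cover_def by (intro card_ge_of_in_closed) auto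
  then show ?thesis using assms(3) by linarith
qed

lemma back_cover_card_ge':
  assumes "A \<subseteq> V" "back_cover A W" "card W \<le> 2 * M" "2 * M < card (V - A)"
  shows "2 * d + 1 \<le> card (V - A - W) + 4 * M"
  using semidegree_tournament.back_cover_card_ge[OF semidegree_tournament_converse
      Diff_subset back_cover_converse[OF assms(1,2)] assms(3,4)] .

section \<open>Cuts with a tiny side\<close>

lemma card_avoiding_le:
  assumes "N \<subseteq> V" "2 * M \<le> card N"
  shows "4 ^ M * card {S. S \<subseteq> V \<and> S \<inter> N = {}} \<le> 2 ^ card V"
proof -
  have "{S. S \<subseteq> V \<and> S \<inter> N = {}} = Pow (V - N)" by auto
  moreover have "card (V - N) = card V - card N" "card N \<le> card V"
    using assms finite_V finite_sub by (auto intro: card_Diff_subset card_mono)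
  ultimately have "4 ^ M * card {S. S \<subseteq> V \<and> S \<inter> N = {}} = (2 ^ 2) ^ M * 2 ^ (card V - card N)"
    using finite_V by (simp add: card_Pow)
  also have "\<dots> = 2 ^ (2 * M + (card V - card N))"
    unfolding power_mult[symmetric] power_add ..
  also have "\<dots> \<le> 2 ^ card V"
    using assms(2) \<open>card N \<le> card V\<close> by (intro power_increasing) auto
  finally show ?thesis .
qed

text \<open>\<open>S\<close> contains some \<open>a\<close> in \<open>A\<close> and misses all
  in-neighbours of \<open>a\<close> outside \<open>A\<close>, of which there are at least
  \<open>d - 2 * M\<close>. The union bound over \<open>a\<close> costs a factor
  \<open>2 * M\<close>, weakened to \<open>3 ^ M\<close> to match the other bounds.\<close>

lemma card_cut_small_side:
  assumes A: "A \<subseteq> V" "card A \<le> 2 * M" and M: "4 * M \<le> d"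
  shows "4 ^ M * card {S. S \<subseteq> V \<and> cut S A} \<le> 3 ^ M * 2 ^ card V"
proof -
  let ?N = "\<lambda>a. {u\<in>V - A. E u a}"
  let ?F = "\<lambda>a. {S. S \<subseteq> V \<and> S \<inter> ?N a = {}}"
  have finA: "finite A" using A(1) by (rule finite_sub)
  have N: "2 * M \<le> card (?N a)" if "a \<in> A" for a
  proof -
    have "d \<le> card {u\<in>V. E u a}" using that A in_degree_ge by blast
    also have "\<dots> \<le> card (?N a \<union> A)" using finite_V finA by (intro card_mono) auto
    also have "\<dots> \<le> card (?N a) + card A" by (rule card_Un_le)
    finally show ?thesis using A(2) M by linarith
  qed
  have "{S. S \<subseteq> V \<and> cut S A} \<subseteq> (\<Union>a\<in>A. ?F a)"
    unfolding cut_def by blast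
  then have "card {S. S \<subseteq> V \<and> cut S A} \<le> card (\<Union>a\<in>A. ?F a)"
    using finA finite_V by (intro card_mono finite_UN_I) auto
  also have "\<dots> \<le> (\<Sum>a\<in>A. card (?F a))" using finA by (rule card_UN_le)
  finally have "4 ^ M * card {S. S \<subseteq> V \<and> cut S A} \<le> 4 ^ M * (\<Sum>a\<in>A. card (?F a))" by simp
  also have "\<dots> \<le> (\<Sum>a\<in>A. 2 ^ card V)"
    unfolding sum_distrib_left using N by (intro sum_mono card_avoiding_le) auto
  also have "\<dots> \<le> 2 * M * 2 ^ card V" using A(2) by simp
  also have "2 * M \<le> 3 ^ M"
  proof (induction M)
    case (Suc M)
    moreover have "(1::nat) \<le> 3 ^ M" by simp
    ultimately show ?case unfolding power_Suc mult_Suc_right by linarith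
  qed simp
  finally show ?thesis by simp
qed

lemma card_cut_small_side':
  assumes A: "A \<subseteq> V" "card (V - A) \<le> 2 * M" and M: "4 * M \<le> d"
  shows "4 ^ M * card {S. S \<subseteq> V \<and> cut S A} \<le> 3 ^ M * 2 ^ card V"
proof -
  interpret rev: semidegree_tournament V "\<lambda>x y. E y x" d
    by (rule semidegree_tournament_converse)
  have "rev.cut S (V - A) \<longleftrightarrow> cut S A" if "S \<subseteq> V" for S
  proof -
    have "S \<inter> (V - A) = S - A" "S - (V - A) = S \<inter> A" using that by auto
    then show ?thesis unfolding rev.cut_def cut_def by auto
  qed
  then have "{S. S \<subseteq> V \<and> cut S A} = {S. S \<subseteq> V \<and> rev.cut S (V - A)}" by blast
  then show ?thesis using rev.card_cut_small_side[of "V - A" M] A(2) M by simp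
qed

text \<open>The in-degrees of the at most \<open>2 * d\<close> vertices of \<open>A\<close> sum to at least \<open>d * card A\<close>, while
  arcs inside \<open>A\<close> contribute only \<open>card A * (card A - 1) / 2\<close>; the deficit consists of backward arcs.\<close>

lemma card_le_of_sparse_back:
  assumes A: "A \<subseteq> V" "2 * card A \<le> card V" and W: "back_cover A W" "card W \<le> 2 * M"
    and w1: "\<And>w. w \<in> W \<inter> A \<Longrightarrow> card {u\<in>V - A. E u w} \<le> c"
    and w2: "\<And>w. w \<in> W - A \<Longrightarrow> card {u\<in>A. E w u} \<le> c"
  shows "card A \<le> 4 * M * c"
proof -
  interpret A: fin_tournament A E using A(1) by (rule fin_tournament_subset)
  let ?m = "card A" and ?b = "\<lambda>x. card {u\<in>V - A. E u x}"
  have finW: "finite W" using W(1) finite_sub unfolding back_cover_def by blast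
  have "?m * d \<le> (\<Sum>x\<in>A. card {u\<in>A. E u x} + ?b x)"
  proof -
    have "?m * d = (\<Sum>x\<in>A. d)" by simp
    also have "\<dots> \<le> (\<Sum>x\<in>A. card {u\<in>A. E u x} + ?b x)"
    proof (rule sum_mono)
      fix x assume "x \<in> A"
      then have "d \<le> card {u\<in>V. E u x}" using A(1) in_degree_ge by blast
      also have "{u\<in>V. E u x} = {u\<in>A. E u x} \<union> {u\<in>V - A. E u x}" using A(1) by blast
      also have "card \<dots> \<le> card {u\<in>A. E u x} + ?b x" by (rule card_Un_le)
      finally show "d \<le> card {u\<in>A. E u x} + ?b x" .
    qed
    finally show ?thesis .
  qed
  then have "2 * (?m * d) \<le> ?m * (?m - 1) + 2 * (\<Sum>x\<in>A. ?b x)"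
    using A.sum_in_degree by (simp add: sum.distrib)
  \<comment> \<open>Here the exact semidegree bound matters: the arcs inside \<open>A\<close> fall
    short of \<open>d * card A\<close> by at least \<open>card A / 2\<close>.\<close>
  moreover have "?m \<le> 2 * d" using A(2) card_V_le by linarith
  then have "?m * (?m - 1) + ?m \<le> 2 * (?m * d)"
  proof -
    have "?m * (?m - 1) + ?m = ?m * ?m" by (cases ?m) auto
    also have "\<dots> \<le> ?m * (2 * d)" using \<open>?m \<le> 2 * d\<close> by (rule mult_left_mono) simp
    finally show ?thesis by (simp add: ac_simps)
  qed
  ultimately have "?m \<le> 2 * (\<Sum>x\<in>A. ?b x)" by linarith
  \<comment> \<open>A backward arc has its head in \<open>W \<inter> A\<close> or its tail in
    \<open>W - A\<close>, and each of these vertices accounts for at most \<open>c\<close>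
    arcs.\<close>
  moreover have "(\<Sum>x\<in>A. ?b x) = (\<Sum>x\<in>W \<inter> A. ?b x) + (\<Sum>x\<in>A - W. ?b x)"
    using A.finite_V by (subst Int_commute) (rule sum.Int_Diff)
  moreover have "(\<Sum>x\<in>W \<inter> A. ?b x) \<le> card (W \<inter> A) * c"
    using w1 sum_mono[of "W \<inter> A" ?b "\<lambda>_. c"] by simp
  moreover have "(\<Sum>x\<in>A - W. ?b x) \<le> card (W - A) * c"
  proof -
    have "(\<Sum>x\<in>A - W. ?b x) \<le> (\<Sum>x\<in>A - W. card {u\<in>W - A. E u x})"
      using W(1) finW unfolding back_cover_def by (intro sum_mono card_mono) auto
    also have "\<dots> = (\<Sum>x\<in>A - W. \<Sum>u\<in>W - A. if E u x then 1 else 0)"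
      using finW by (simp add: sum.If_cases Int_def)
    also have "\<dots> = (\<Sum>u\<in>W - A. \<Sum>x\<in>A - W. if E u x then 1 else 0)" by (rule sum.swap)
    also have "\<dots> = (\<Sum>u\<in>W - A. card {x\<in>A - W. E u x})"
      using A.finite_V by (simp add: sum.If_cases Int_def)
    also have "\<dots> \<le> (\<Sum>u\<in>W - A. c)"
    proof (rule sum_mono)
      fix u assume "u \<in> W - A"
      have "card {x\<in>A - W. E u x} \<le> card {x\<in>A. E u x}"
        using A.finite_V by (intro card_mono) auto
      also have "\<dots> \<le> c" using w2 \<open>u \<in> W - A\<close> by blast
      finally show "card {x\<in>A - W. E u x} \<le> c" .
    qed
    finally show ?thesis by simp
  qed
  moreover have "card (W \<inter> A) * c + card (W - A) * c = card W * c"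
    using card_Int_Diff[OF finW, of A] by (simp add: distrib_right)
  moreover have "card W * c \<le> 2 * M * c" using W(2) by simp
  ultimately show ?thesis by linarith
qed

text \<open>If no such vertex existed, moving the vertices of \<open>W\<close> to the appropriate sides would leave
  only about \<open>M\<^sup>2\<close> backward arcs, whereas the semidegree condition forces linearly many.\<close>

lemma ex_mixed_vertex:
  assumes A: "A \<subseteq> V" "2 * M < card A" "2 * M < card (V - A)"
    and W: "back_cover A W" "card W \<le> 2 * M"
    and M: "0 < M" "130 * M\<^sup>2 \<le> card V"
  shows "\<exists>w\<in>V. 12 * M \<le> card {u\<in>V - A. E u w} \<and> 12 * M \<le> card {u\<in>A. E w u}"
proof (rule ccontr)
  assume neg: "\<not> ?thesis"
  \<comment> \<open>Vertices of \<open>W\<close> with few in-neighbours across the cut go to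
    \<open>A'\<close>; by \<open>neg\<close>, the other ones have few out-neighbours in
    \<open>A\<close> and can go to the opposite side.\<close>
  define A' where "A' = (A - W) \<union> {w\<in>W. card {u\<in>V - A. E u w} < 12 * M}"
  have WV: "W \<subseteq> V" and finW: "finite W" using W(1) finite_sub unfolding back_cover_def by auto
  have A': "A' \<subseteq> V" using A(1) WV unfolding A'_def by blast
  have cov: "back_cover A' W"
    using W(1) A(1) unfolding back_cover_def A'_def by blast
  have w1: "card {u\<in>V - A'. E u w} \<le> 14 * M" if "w \<in> W \<inter> A'" for w
  proof -
    have "card {u\<in>V - A'. E u w} \<le> card ({u\<in>V - A. E u w} \<union> W)"
      using finite_V finW unfolding A'_def by (intro card_mono) auto
    also have "\<dots> \<le> card {u\<in>V - A. E u w} + card W" by (rule card_Un_le)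
    also have "\<dots> \<le> 12 * M + 2 * M" using that W(2) unfolding A'_def by (intro add_mono) auto
    finally show ?thesis by simp
  qed
  have w2: "card {u\<in>A'. E w u} \<le> 14 * M" if "w \<in> W - A'" for w
  proof -
    have "card {u\<in>A'. E w u} \<le> card ({u\<in>A. E w u} \<union> W)"
      using finite_sub[OF A(1)] finW unfolding A'_def by (intro card_mono) auto
    also have "\<dots> \<le> card {u\<in>A. E w u} + card W" by (rule card_Un_le)
    also have "\<dots> \<le> 12 * M + 2 * M"
      using that W(2) neg WV unfolding A'_def by (intro add_mono) (auto simp: not_le)
    finally show ?thesis by simp
  qed
  have "card (A - W) \<le> card A'"
    using finite_sub[OF A'] unfolding A'_def by (intro card_mono) auto
  then have s1: "2 * d + 1 \<le> card A' + 4 * M"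
    using back_cover_card_ge[OF A(1) W A(2)] by linarith
  have "card (V - A - W) \<le> card (V - A')"
    using finite_V unfolding A'_def by (intro card_mono) auto
  then have s2: "2 * d + 1 \<le> card (V - A') + 4 * M"
    using back_cover_card_ge'[OF A(1) W A(3)] by linarith
  have cs: "card A' + card (V - A') = card V"
    using A' finite_V by (metis card_Int_Diff inf.absorb_iff2)
  have "card A' \<le> 4 * M * (14 * M) \<or> card (V - A') \<le> 4 * M * (14 * M)"
  proof (cases "2 * card A' \<le> card V")
    case True
    then show ?thesis using card_le_of_sparse_back[OF A' True cov W(2) w1 w2] by blast
  next
    case False
    interpret rev: semidegree_tournament V "\<lambda>x y. E y x" d
      by (rule semidegree_tournament_converse)
    have eq: "V - (V - A') = A'" "W \<inter> (V - A') = W - A'" "W - (V - A') = W \<inter> A'"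
      using A' WV by auto
    have "card (V - A') \<le> 4 * M * (14 * M)"
      using False cs w1 w2 W(2) back_cover_converse[OF A' cov]
      by (intro rev.card_le_of_sparse_back[of _ W]) (auto simp: eq)
    then show ?thesis by blast
  qed
  \<comment> \<open>One side is both large by \<open>s1\<close> or \<open>s2\<close> and at most
    \<open>4 * M * (14 * M)\<close>. Hence \<open>4 * d + 1 < 120 * M\<^sup>2\<close>, contradicting
    the lower bound on \<open>card V\<close>.\<close>
  then have "2 * d + 1 \<le> 56 * M\<^sup>2 + 4 * M"
    using s1 s2 by (auto simp: power2_eq_square)
  moreover have "M \<le> M\<^sup>2" by (simp add: power2_eq_square)
  ultimately show False using M card_V_le by linarith
qed

text \<open>By \<open>disj\<close>, \<open>A - A'\<close> lies in \<open>W \<union> W'\<close>.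
  Conversely, \<open>A' \<inter> A\<close> has at least \<open>2 * d + 1 - 6 * M\<close> elements,
  while the size of \<open>V - A'\<close> limits \<open>A'\<close> to
  \<open>2 * d + 4 * M\<close>.\<close>

lemma card_diff_le_aux:
  assumes A: "A \<subseteq> V" "2 * M < card A"
    and W: "back_cover A W" "card W \<le> 2 * M"
    and A': "A' \<subseteq> V" "2 * M < card (V - A')"
    and W': "back_cover A' W'" "card W' \<le> 2 * M"
    and disj: "(A - W) \<inter> (V - A' - W') = {}"
  shows "card (A - A') \<le> 10 * M" "card (A' - A) \<le> 10 * M"
proof -
  have fin: "finite W" "finite W'" "finite A" "finite A'" 
    using W(1) W'(1) A(1) A'(1) finite_sub unfolding back_cover_def by auto
  have "card (A - A') \<le> card (W \<union> W')"
    using disj A(1) fin by (intro card_mono) auto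
  also have "\<dots> \<le> card W + card W'" by (rule card_Un_le)
  finally show "card (A - A') \<le> 10 * M" using W(2) W'(2) by linarith
  have "card (A - W) \<le> card (A' \<inter> A \<union> W')"
    using disj A(1) fin by (intro card_mono) auto
  also have "\<dots> \<le> card (A' \<inter> A) + card W'" by (rule card_Un_le)
  finally have "2 * d + 1 \<le> card (A' \<inter> A) + 6 * M"
    using back_cover_card_ge[OF A(1) W A(2)] W'(2) by linarith
  moreover have "card (V - A' - W') \<le> card (V - A')" using finite_V by (intro card_mono) auto
  then have "2 * d + 1 \<le> card (V - A') + 4 * M"
    using back_cover_card_ge'[OF A'(1) W' A'(2)] by linarith
  moreover have "card A' + card (V - A') = card V"
    using A'(1) finite_V by (metis card_Int_Diff inf.absorb_iff2)
  moreover have "card A' = card (A' \<inter> A) + card (A' - A)"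
    using fin by (intro card_Int_Diff)
  ultimately show "card (A' - A) \<le> 10 * M" using card_V_le by linarith
qed

text \<open>If uncovered vertices \<open>p\<close> in \<open>A - A'\<close> and \<open>q\<close> in
  \<open>A' - A\<close> both existed, the arc between them would be backward for one of the cuts and
  avoid its cover.\<close>

lemma card_diff_le:
  assumes A: "A \<subseteq> V" "2 * M < card A" "2 * M < card (V - A)"
    and W: "back_cover A W" "card W \<le> 2 * M"
    and A': "A' \<subseteq> V" "2 * M < card A'" "2 * M < card (V - A')"
    and W': "back_cover A' W'" "card W' \<le> 2 * M"
  shows "card (A - A') \<le> 10 * M" "card (A' - A) \<le> 10 * M"
proof -
  have "(A - W) \<inter> (V - A' - W') = {} \<or> (A' - W') \<inter> (V - A - W) = {}"
  proof (rule ccontr)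
    assume "\<not> ?thesis"
    then obtain p q where p: "p \<in> A - W" "p \<in> V - A' - W'"
      and q: "q \<in> A' - W'" "q \<in> V - A - W" by blast
    then have "\<not> E q p" "\<not> E p q" using W(1) W'(1) unfolding back_cover_def by blast+
    moreover have "p \<noteq> q" using p q by blast
    ultimately show False using total[of p q] p q by blast
  qed
  then show "card (A - A') \<le> 10 * M" "card (A' - A) \<le> 10 * M"
    using card_diff_le_aux[OF A(1,2) W A'(1,3) W'] card_diff_le_aux[OF A'(1,2) W' A(1,3) W]
    by blast+
qed

text \<open>On either side of the cut, \<open>w\<close> forbids to \<open>S\<close> its backward
  neighbours across \<open>A\<close>. At most \<open>10 * M\<close> of the \<open>12 * M\<close> are
  lost in passing from \<open>A\<^sub>0\<close> to \<open>A\<close>, so \<open>2 * M\<close>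
  remain.\<close>

lemma card_cut_mixed_vertex:
  assumes A: "A \<subseteq> V" and d: "card (A - A\<^sub>0) \<le> 10 * M" "card (A\<^sub>0 - A) \<le> 10 * M"
    and w: "12 * M \<le> card {u\<in>V - A\<^sub>0. E u w}" "12 * M \<le> card {u\<in>A\<^sub>0. E w u}" and A0: "A\<^sub>0 \<subseteq> V"
  shows "4 ^ M * card {S. S \<subseteq> V \<and> w \<in> S \<and> cut S A} \<le> 3 ^ M * 2 ^ card V"
proof -
  have fin: "finite (A - A\<^sub>0)" "finite (A\<^sub>0 - A)" using A A0 finite_sub by auto
  have *: "4 ^ M * card {S. S \<subseteq> V \<and> w \<in> S \<and> cut S A} \<le> 3 ^ M * 2 ^ card V"
    if N: "N \<subseteq> V" "2 * M \<le> card N" "\<And>S. w \<in> S \<Longrightarrow> cut S A \<Longrightarrow> S \<inter> N = {}" for N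
  proof -
    have "4 ^ M * card {S. S \<subseteq> V \<and> w \<in> S \<and> cut S A} \<le> 4 ^ M * card {S. S \<subseteq> V \<and> S \<inter> N = {}}"
      using N(3) finite_V by (intro mult_left_mono card_mono) auto
    also have "\<dots> \<le> 2 ^ card V" using N(1,2) by (rule card_avoiding_le)
    also have "\<dots> \<le> 3 ^ M * 2 ^ card V" by simp
    finally show ?thesis .
  qed
  show ?thesis
  proof (cases "w \<in> A")
    case True
    have "card {u\<in>V - A\<^sub>0. E u w} \<le> card ({u\<in>V - A. E u w} \<union> (A - A\<^sub>0))"
      using finite_V fin by (intro card_mono) auto
    also have "\<dots> \<le> card {u\<in>V - A. E u w} + card (A - A\<^sub>0)" by (rule card_Un_le)
    finally have "2 * M \<le> card {u\<in>V - A. E u w}" using w(1) d(1) by linarith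
    then show ?thesis using True by (intro *[of "{u\<in>V - A. E u w}"]) (auto simp: cut_def)
  next
    case False
    have "card {u\<in>A\<^sub>0. E w u} \<le> card ({u\<in>A. E w u} \<union> (A\<^sub>0 - A))"
      using finite_sub[OF A] fin by (intro card_mono) auto
    also have "\<dots> \<le> card {u\<in>A. E w u} + card (A\<^sub>0 - A)" by (rule card_Un_le)
    finally have "2 * M \<le> card {u\<in>A. E w u}" using w(2) d(2) by linarith
    then show ?thesis using False A by (intro *[of "{u\<in>A. E w u}"]) (auto simp: cut_def)
  qed
qed

section \<open>The pivot vertex and the union bound\<close>

lemma back_cover_or_few_cut:
  assumes "A \<subseteq> V"
  shows "(\<exists>W. back_cover A W \<and> card W \<le> 2 * M) \<or>
    4 ^ M * card {S. S \<subseteq> V \<and> cut S A} \<le> 3 ^ M * 2 ^ card V"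
proof -
  \<comment> \<open>\<open>?R x y\<close> is a backward arc from \<open>y\<close> to
    \<open>x\<close>; a set cut by \<open>A\<close> contains none.\<close>
  let ?R = "\<lambda>x y. x \<in> A \<and> y \<notin> A \<and> E y x"
  let ?I = "{S. S \<subseteq> V \<and> (\<forall>x\<in>S. \<forall>y\<in>S. \<not> ?R x y)}"
  have sub: "{S. S \<subseteq> V \<and> cut S A} \<subseteq> ?I" unfolding cut_def by blast
  have "card {S. S \<subseteq> V \<and> cut S A} \<le> card ?I"
    using finite_V by (intro card_mono sub) auto
  then have "4 ^ M * card {S. S \<subseteq> V \<and> cut S A} \<le> 4 ^ M * card ?I" by simp
  moreover have "(\<exists>W\<subseteq>V. card W \<le> 2 * M \<and> (\<forall>x\<in>V - W. \<forall>y\<in>V - W. \<not> ?R x y)) \<or>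
    4 ^ M * card ?I \<le> 3 ^ M * 2 ^ card V"
    using finite_V by (intro cover_or_few_independent) auto
  moreover have "back_cover A W" if "W \<subseteq> V" "\<forall>x\<in>V - W. \<forall>y\<in>V - W. \<not> ?R x y" for W
    using that assms unfolding back_cover_def by blast
  ultimately show ?thesis by (meson le_trans)
qed

text \<open>All balanced cuts with a small cover are close to one another, so a vertex that is mixed for one
  of them has many backward arcs across each of them.\<close>

lemma ex_pivot:
  assumes M: "0 < M" "130 * M\<^sup>2 \<le> card V"
  shows "\<exists>w\<in>V. \<forall>A\<subseteq>V. 4 ^ M * card {S. S \<subseteq> V \<and> w \<in> S \<and> cut S A} \<le> 3 ^ M * 2 ^ card V"
proof -
  define balanced where "balanced A W \<longleftrightarrow> A \<subseteq> V \<and> 2 * M < card A \<and> 2 * M < card (V - A) \<and>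
    back_cover A W \<and> card W \<le> 2 * M" for A W
  have "M \<le> M\<^sup>2" by (simp add: power2_eq_square)
  then have d: "4 * M \<le> d" using M card_V_le by linarith
  \<comment> \<open>Without balance, \<open>A\<close> or \<open>V - A\<close> is tiny, or the
    backward arcs have no cover of size \<open>2 * M\<close>.\<close>
  have few: "4 ^ M * card {S. S \<subseteq> V \<and> w \<in> S \<and> cut S A} \<le> 3 ^ M * 2 ^ card V"
    if "A \<subseteq> V" "\<nexists>W. balanced A W" for A w
  proof -
    have "4 ^ M * card {S. S \<subseteq> V \<and> w \<in> S \<and> cut S A} \<le> 4 ^ M * card {S. S \<subseteq> V \<and> cut S A}"
      using finite_V by (intro mult_left_mono card_mono) auto
    also have "\<dots> \<le> 3 ^ M * 2 ^ card V"
      using that back_cover_or_few_cut[of A M] card_cut_small_side[of A M]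
        card_cut_small_side'[of A M] d unfolding balanced_def by (meson not_less)
    finally show ?thesis .
  qed
  show ?thesis
  proof (cases "\<exists>A W. balanced A W")
    case False
    \<comment> \<open>With no balanced cut at all, any vertex serves as the pivot.\<close>
    have "V \<noteq> {}" using M by auto
    then show ?thesis using few False by blast
  next
    case True
    then obtain A\<^sub>0 W\<^sub>0 where 0: "balanced A\<^sub>0 W\<^sub>0" by blast
    then obtain w where w: "w \<in> V" "12 * M \<le> card {u\<in>V - A\<^sub>0. E u w}" "12 * M \<le> card {u\<in>A\<^sub>0. E w u}"
      using ex_mixed_vertex[of A\<^sub>0 M W\<^sub>0] M unfolding balanced_def by blast
    have "4 ^ M * card {S. S \<subseteq> V \<and> w \<in> S \<and> cut S A} \<le> 3 ^ M * 2 ^ card V" if "A \<subseteq> V" for A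
    proof (cases "\<exists>W. balanced A W")
      case True
      then obtain W where "balanced A W" by blast
      then show ?thesis
        using card_cut_mixed_vertex[of A A\<^sub>0 M w] card_diff_le[of A M W A\<^sub>0 W\<^sub>0] 0 w M
        unfolding balanced_def by blast
    next
      case False
      then show ?thesis using few that by blast
    qed
    then show ?thesis using w(1) by blast
  qed
qed

text \<open>The sets missing the pivot are all conceded, which costs one half of all subsets; the
  sets containing it fall under the union bound over cuts.\<close>

lemma card_cuttable_le:
  assumes M: "0 < M" "130 * M\<^sup>2 \<le> card V" and k: "card V < 2 ^ k"
  shows "4 ^ M * card {S. S \<subseteq> V \<and> (\<exists>A. cut S A)} \<le>
    card V ^ k * (3 ^ M * 2 ^ card V) + 4 ^ M * 2 ^ (card V - 1)"
proof -
  obtain w where w: "w \<in> V"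
    "\<And>A. A \<subseteq> V \<Longrightarrow> 4 ^ M * card {S. S \<subseteq> V \<and> w \<in> S \<and> cut S A} \<le> 3 ^ M * 2 ^ card V"
    using ex_pivot[OF M] by blast
  let ?B = "{S. S \<subseteq> V \<and> w \<in> S \<and> (\<exists>A. cut S A)}"
  have "{S. S \<subseteq> V \<and> (\<exists>A. cut S A)} \<subseteq> ?B \<union> Pow (V - {w})" by blast
  then have "card {S. S \<subseteq> V \<and> (\<exists>A. cut S A)} \<le> card (?B \<union> Pow (V - {w}))"
    using finite_V by (intro card_mono) auto
  also have "\<dots> \<le> card ?B + card (Pow (V - {w}))" by (rule card_Un_le)
  also have "card (Pow (V - {w})) = 2 ^ (card V - 1)" using finite_V w(1) by (simp add: card_Pow)
  finally have "4 ^ M * card {S. S \<subseteq> V \<and> (\<exists>A. cut S A)} \<le> 4 ^ M * card ?B + 4 ^ M * 2 ^ (card V - 1)"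
    by (simp flip: distrib_left)
  also have "4 ^ M * card ?B \<le> card V ^ k * (3 ^ M * 2 ^ card V)"
    using k w(2) by (rule card_cut_sets_le[where P = "\<lambda>S. w \<in> S"])
  finally show ?thesis by simp
qed

end

subsection \<open>Camion's theorem\<close>

context fin_tournament begin

text \<open>A single vertex counts as a closed cycle, so that the extremal argument below always has a
  cycle to start from.\<close>

definition closed_cycle :: "'a list \<Rightarrow> bool" where
  "closed_cycle xs \<longleftrightarrow> xs \<noteq> [] \<and> distinct xs \<and> successively E xs \<and>
    (hd xs = last xs \<or> E (last xs) (hd xs))"

lemma closed_cycle_swap:
  assumes "closed_cycle (us @ vs)"
  shows "closed_cycle (vs @ us)"
proof (cases "us = [] \<or> vs = []")
  case True
  then show ?thesis using assms by auto
next
  case False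
  then have "hd us \<in> set us" "last vs \<in> set vs" by auto
  then have "hd us \<noteq> last vs" using assms unfolding closed_cycle_def by auto
  then show ?thesis using assms False unfolding closed_cycle_def
    by (auto simp: successively_append_iff)
qed

lemma closed_cycle_append:
  assumes "closed_cycle xs" "distinct (xs @ ws)" "ws \<noteq> []" "successively E ws"
    "E (last xs) (hd ws)" "E (last ws) (hd xs)"
  shows "closed_cycle (xs @ ws)"
  using assms unfolding closed_cycle_def by (auto simp: successively_append_iff)

text \<open>Going round the cycle from \<open>x\<close>, the last vertex with an arc into
  \<open>v\<close> is followed by one that \<open>v\<close> dominates, and \<open>v\<close> fits
  between these two.\<close>

lemma closed_cycle_insert:
  assumes xs: "closed_cycle xs" "set xs \<subseteq> V" and v: "v \<in> V" "v \<notin> set xs"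
    and x: "x \<in> set xs" "E v x" and y: "y \<in> set xs" "E y v"
  shows "\<exists>ys. closed_cycle ys \<and> set ys = insert v (set xs)"
proof -
  obtain as bs where "xs = as @ x # bs" using x(1) by (meson split_list)
  \<comment> \<open>Rotated to start with \<open>x\<close>: if the last in-neighbour
    \<open>y'\<close> of \<open>v\<close> ends the list, its successor is \<open>x\<close>.\<close>
  then have zs: "closed_cycle (x # bs @ as)" "set (x # bs @ as) = set xs"
    using closed_cycle_swap[of as "x # bs"] xs(1) by auto
  obtain us y' vs where spl: "x # bs @ as = us @ y' # vs" "E y' v" "\<forall>z\<in>set vs. \<not> E z v"
    using split_list_last_prop[of "x # bs @ as" "\<lambda>y. E y v"] y zs(2) by blast
  have cyc: "closed_cycle (vs @ us @ [y'])"
    using closed_cycle_swap[of "us @ [y']" vs] zs(1) spl(1) by simp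
  have set: "set (vs @ us @ [y']) = set xs" using spl(1) zs(2) by auto
  have "E v (hd (vs @ us @ [y']))"
  proof (cases vs)
    case Nil
    then have "hd (vs @ us @ [y']) = x" using spl(1) by (cases us) auto
    then show ?thesis using x(2) by simp
  next
    case (Cons z vs')
    then have "z \<in> set xs" "\<not> E z v" using spl(3) set by auto
    then show ?thesis using total[of z v] v xs(2) Cons by auto
  qed
  then have "closed_cycle ((vs @ us @ [y']) @ [v])"
    using spl(2) v(2) set cyc
    by (intro closed_cycle_append[OF cyc]) (auto simp: closed_cycle_def simp del: append_assoc)
  moreover have "set ((vs @ us @ [y']) @ [v]) = insert v (set xs)" using set by auto
  ultimately show ?thesis by blast
qed

text \<open>Camion's theorem: a vertex outside a longest cycle cannot be inserted into it, so it
  dominates the cycle or is dominated by it; and no arc leads from the latter vertices to the former,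
  or else it could be inserted as a whole.\<close>

lemma ex_closed_cycle_or_cut:
  assumes S: "S \<subseteq> V" "S \<noteq> {}"
  shows "(\<exists>xs. closed_cycle xs \<and> set xs = S) \<or> (\<exists>A. cut S A)"
proof -
  let ?P = "\<lambda>xs. closed_cycle xs \<and> set xs \<subseteq> S"
  obtain s where "s \<in> S" using S(2) by blast
  then have "?P [s]" by (simp add: closed_cycle_def)
  moreover have "length ys < Suc (card S)" if "?P ys" for ys
    using that card_mono[OF finite_sub[OF S(1)]] distinct_card[of ys]
    unfolding closed_cycle_def by (metis le_imp_less_Suc)
  ultimately obtain xs where xs: "?P xs" and max: "\<And>ys. ?P ys \<Longrightarrow> length ys \<le> length xs"
    using ex_has_greatest_nat[of ?P "[s]" length "Suc (card S)"] by blast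
  let ?C = "set xs"
  have "xs \<noteq> []" "distinct xs" using xs unfolding closed_cycle_def by auto
  then have ends: "hd xs \<in> ?C" "last xs \<in> ?C" by auto
  have longer: "False" if "closed_cycle ys" "set ys \<subseteq> S" "?C \<subset> set ys" for ys
  proof -
    have "card ?C < card (set ys)" using that(3) by (intro psubset_card_mono) auto
    then show False using max[of ys] that(1,2) \<open>distinct xs\<close>
      by (simp add: distinct_card closed_cycle_def)
  qed
  define I where "I = {v \<in> S - ?C. \<forall>x\<in>?C. E v x}"
  define J where "J = {v \<in> S - ?C. \<forall>x\<in>?C. E x v}"
  have IJ: "v \<in> I \<or> v \<in> J" if v: "v \<in> S - ?C" for v
  proof (rule ccontr)
    assume "\<not> ?thesis"
    then obtain x y where xy: "x \<in> ?C" "\<not> E v x" "y \<in> ?C" "\<not> E y v"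
      using v unfolding I_def J_def by blast
    then have "E x v" "E v y" using total[of x v] total[of y v] xs S(1) v by auto
    then obtain ys where ys: "closed_cycle ys" "set ys = insert v ?C"
      using closed_cycle_insert[of xs v y x] xs S(1) v xy(1,3) by blast
    show False using longer[OF ys(1)] ys(2) v xs by auto
  qed
  have no_arc: "\<not> E j i" if i: "i \<in> I" and j: "j \<in> J" for i j
  proof
    assume "E j i"
    have "i \<noteq> j" "i \<notin> ?C" "j \<notin> ?C" "i \<in> S" "j \<in> S" "E i (hd xs)" "E (last xs) j"
      using i j ends asym unfolding I_def J_def by blast+
    then have "closed_cycle (xs @ [j, i])"
      using xs \<open>E j i\<close> \<open>distinct xs\<close> by (intro closed_cycle_append[of xs]) auto
    then show False
      using longer[of "xs @ [j, i]"] xs \<open>i \<in> S\<close> \<open>j \<in> S\<close> \<open>i \<notin> ?C\<close> by auto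
  qed
  \<comment> \<open>\<open>I\<close> receives no arc from the cycle or from \<open>J\<close>, so it
    gives a cut when nonempty. Otherwise all outside vertices lie in \<open>J\<close>, and the cycle
    itself is the first side.\<close>
  show ?thesis
  proof (cases "I = {}")
    case False
    have "I \<subseteq> S - ?C" unfolding I_def by blast
    have "\<not> E b a" if ab: "a \<in> I" "b \<in> S - I" for a b
    proof (cases "b \<in> ?C")
      case True
      then show ?thesis using ab asym unfolding I_def by blast
    next
      case False
      then show ?thesis using ab IJ no_arc by blast
    qed
    then have "cut S I"
      using False \<open>I \<subseteq> S - ?C\<close> ends xs unfolding cut_def by blast
    then show ?thesis by blast
  next
    case True
    show ?thesis
    proof (cases "?C = S")
      case False
      have "\<not> E b a" if "a \<in> ?C" "b \<in> S - ?C" for a b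
        using that True IJ asym unfolding J_def by blast
      then have "cut S ?C" using False ends xs unfolding cut_def by blast
      then show ?thesis by blast
    qed (use xs in blast)
  qed
qed

end

subsection \<open>Transfer to digraphs\<close>

lemma (in wf_digraph) ex_awalk_verts_eq:
  assumes "successively (dominates G) (u # xs)" "u \<in> verts G"
  shows "\<exists>p. awalk u p (last (u # xs)) \<and> awalk_verts u p = u # xs"
  using assms
proof (induction xs arbitrary: u)
  case Nil
  then show ?case by (intro exI[of _ "[]"]) (auto simp: awalk_Nil_iff)
next
  case (Cons v xs)
  then obtain e where e: "e \<in> arcs G" "tail G e = u" "head G e = v"
    by (auto simp: successively_Cons)
  then have "v \<in> verts G" by auto
  with Cons obtain p where "awalk v p (last (v # xs))" "awalk_verts v p = v # xs"
    by (auto simp: successively_Cons)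
  then show ?case using e by (intro exI[of _ "e # p"]) (auto simp: awalk_Cons_iff)
qed

lemma (in wf_digraph) hamiltonian_of_vertex_cycle:
  assumes "xs \<noteq> []" "distinct xs" "set xs = verts G" "successively (dominates G) (xs @ [hd xs])"
  shows "hamiltonian G"
proof -
  obtain u us where xs: "xs = u # us" using assms(1) by (cases xs) auto
  obtain p where p: "awalk u p u" "awalk_verts u p = xs @ [u]"
    using ex_awalk_verts_eq[of u "us @ [u]"] assms(3,4) xs by auto
  have "p \<noteq> []" using p(2) xs by auto
  then have "map (tail G) p = xs"
    using p(2) by (simp add: awalk_verts_conv)
  then have "\<forall>v\<in>verts G. \<exists>e\<in>set p. tail G e = v"
    using assms(3) by (metis image_iff list.set_map)
  moreover have "cycle p"
    unfolding cycle_def using p \<open>p \<noteq> []\<close> assms(2) xs by auto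
  ultimately show ?thesis unfolding hamiltonian_def by blast
qed

lemma (in digraph) in_degree_eq_card: "in_degree G v = card {u\<in>verts G. u \<rightarrow> v}"
proof -
  have "inj_on (tail G) (in_arcs G v)"
    by (rule inj_onI) (auto simp: arc_to_ends_def intro: no_multi_arcs)
  moreover have "tail G ` in_arcs G v = {u\<in>verts G. u \<rightarrow> v}"
    by (auto simp: arcs_ends_conv image_iff)
  ultimately show ?thesis unfolding in_degree_def by (metis card_image)
qed

lemma (in digraph) out_degree_eq_card: "out_degree G v = card {u\<in>verts G. v \<rightarrow> u}"
proof -
  have "inj_on (head G) (out_arcs G v)"
    by (rule inj_onI) (auto simp: arc_to_ends_def intro: no_multi_arcs)
  moreover have "head G ` out_arcs G v = {u\<in>verts G. v \<rightarrow> u}"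
    by (auto simp: arcs_ends_conv image_iff)
  ultimately show ?thesis unfolding out_degree_def by (metis card_image)
qed

lemma (in tournament) fin_tournament_dominates: "fin_tournament (verts G) (dominates G)"
proof
  show "finite (verts G)" by simp
  show "\<not> y \<rightarrow> x" if "x \<rightarrow> y" for x y
  proof
    assume "y \<rightarrow> x"
    obtain e e' where e: "e \<in> arcs G" "tail G e = x" "head G e = y"
      and e': "e' \<in> arcs G" "tail G e' = y" "head G e' = x"
      using \<open>x \<rightarrow> y\<close> \<open>y \<rightarrow> x\<close> by blast
    have "x \<noteq> y" using e no_loops by auto
    then have "\<exists>!a. a \<in> arcs G \<and> {tail G a, head G a} = {x, y}"
      using e by (intro ex1_arc) auto
    moreover have "{tail G e, head G e} = {x, y}" "{tail G e', head G e'} = {x, y}"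
      using e e' by auto
    ultimately have "e = e'" using e(1) e'(1) by blast
    then show False using e e' \<open>x \<noteq> y\<close> by simp
  qed
  show "x \<rightarrow> y \<or> y \<rightarrow> x" if "x \<in> verts G" "y \<in> verts G" "x \<noteq> y" for x y
  proof -
    have "\<exists>!e. e \<in> arcs G \<and> {tail G e, head G e} = {x, y}" using that by (rule ex1_arc)
    then obtain e where "e \<in> arcs G" "{tail G e, head G e} = {x, y}" by blast
    then show ?thesis by (auto simp: arcs_ends_conv image_iff doubleton_eq_iff)
  qed
qed

lemma (in tournament) hamiltonian_or_cut:
  assumes S: "S \<subseteq> verts G" "2 \<le> card S"
  shows "hamiltonian (G \<restriction> S) \<or> (\<exists>A. fin_tournament.cut (dominates G) S A)"
proof -
  interpret R: fin_tournament "verts G" "dominates G" by (rule fin_tournament_dominates)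
  interpret GS: wf_digraph "G \<restriction> S" by (rule wellformed_induce_subgraph)
  have "hamiltonian (G \<restriction> S)" if xs: "R.closed_cycle xs" "set xs = S" for xs
  proof -
    have "xs \<noteq> []" "distinct xs" using xs(1) unfolding R.closed_cycle_def by auto
    \<comment> \<open>Two vertices in \<open>S\<close> exclude the degenerate one-vertex cycle, so
      the closing arc exists.\<close>
    moreover have "hd xs \<noteq> last xs"
    proof
      assume "hd xs = last xs"
      then have "length xs = 1" using \<open>distinct xs\<close> \<open>xs \<noteq> []\<close> by (cases xs) (auto split: if_splits)
      then show False using S(2) xs(2) distinct_card[OF \<open>distinct xs\<close>] by simp
    qed
    then have "successively (dominates G) (xs @ [hd xs])"
      using xs(1) unfolding R.closed_cycle_def by (auto simp: successively_append_iff)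
    then have "successively (dominates (G \<restriction> S)) (xs @ [hd xs])"
    proof (rule successively_mono)
      fix x y assume "x \<in> set (xs @ [hd xs])" "y \<in> set (xs @ [hd xs])" "x \<rightarrow> y"
      then show "x \<rightarrow>\<^bsub>G \<restriction> S\<^esub> y"
        using xs(2) \<open>xs \<noteq> []\<close> by (auto simp: arcs_ends_conv image_iff)
    qed
    ultimately show ?thesis using xs(2) by (intro GS.hamiltonian_of_vertex_cycle) auto
  qed
  then show ?thesis using R.ex_closed_cycle_or_cut[OF S(1)] S(2) by fastforce
qed

section \<open>Choice of \<open>M\<close> and \<open>k\<close>\<close>

lemma eventually_cut_parameters:
  "\<exists>err N. err \<longlonglongrightarrow> (0::real) \<and> (\<forall>n\<ge>N. \<exists>M k. 0 < M \<and> 130 * M\<^sup>2 \<le> n \<and> n < 2 ^ k \<and>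
    real n ^ k * (3 / 4) ^ M \<le> err n)"
proof -
  \<comment> \<open>A bound free of roundings: \<open>k\<close> is at most
    \<open>log 2 n + 1\<close> and \<open>M\<close> at least \<open>n powr (1 / 3) - 1\<close>. The
    first factor is of order exp(O((log n)^2)) and loses against the second.\<close>
  let ?err = "\<lambda>n::nat. real n powr (log 2 n + 1) * (3 / 4) powr (real n powr (1 / 3) - 1)"
  have "\<exists>M k. 0 < M \<and> 130 * M\<^sup>2 \<le> n \<and> n < 2 ^ k \<and> real n ^ k * (3 / 4) ^ M \<le> ?err n"
    if n: "2197000 \<le> n" for n
  proof -
    define r where "r = real n powr (1 / 3)"
    define M where "M = nat \<lfloor>r\<rfloor>"
    define k where "k = nat \<lfloor>log 2 n\<rfloor> + 1"
    have n0: "1 \<le> real n" using n by linarith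
    have r3: "r ^ 3 = n" using n0 unfolding r_def by (simp add: powr_power)
    \<comment> \<open>\<open>2197000 = 130 ^ 3\<close>. Then also \<open>M \<ge> 130\<close>, so
      that \<open>130 * M\<^sup>2 \<le> M ^ 3 \<le> n\<close>.\<close>
    have "130 \<le> r"
    proof (rule ccontr)
      assume "\<not> 130 \<le> r"
      then have "r ^ 3 < 130 ^ 3" by (intro power_strict_mono) (auto simp: r_def)
      then show False using r3 n by simp
    qed
    then have M: "130 \<le> M" "real M \<le> r" "r - 1 \<le> real M" unfolding M_def by linarith+
    have M0: "0 < M" using M by simp
    have "real M ^ 3 \<le> r ^ 3" using M by (intro power_mono) auto
    then have "M ^ 3 \<le> n" unfolding r3 by (metis of_nat_le_iff of_nat_power)
    moreover have "130 * M\<^sup>2 \<le> M * M\<^sup>2" using M(1) by (intro mult_right_mono) auto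
    moreover have "M * M\<^sup>2 = M ^ 3" by (simp add: power2_eq_square power3_eq_cube)
    ultimately have Mn: "130 * M\<^sup>2 \<le> n" by linarith
    have l0: "0 \<le> log 2 n" using n0 by simp
    have "log 2 n < k" unfolding k_def using l0 by linarith
    then have "real n < 2 powr k" using n0 by (simp add: log_less_iff)
    then have "real n < real (2 ^ k)" by (simp add: powr_realpow)
    then have kn: "n < 2 ^ k" by (simp only: of_nat_less_iff)
    have "real n ^ k = real n powr k" using n0 by (simp add: powr_realpow)
    also have "\<dots> \<le> real n powr (log 2 n + 1)"
      using n0 l0 unfolding k_def by (intro powr_mono) linarith+
    finally have A: "real n ^ k \<le> real n powr (log 2 n + 1)" .
    have "(3 / 4) ^ M = (3 / 4 :: real) powr M" by (simp add: powr_realpow)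
    also have "\<dots> \<le> (3 / 4) powr (r - 1)" using M(3) by (intro powr_mono') auto
    finally have "real n ^ k * (3 / 4) ^ M \<le> ?err n"
      using A unfolding r_def by (intro mult_mono) auto
    then show ?thesis using M0 Mn kn by blast
  qed
  moreover have "?err \<longlonglongrightarrow> 0" by real_asymp
  ultimately show ?thesis by (intro exI[of _ ?err] exI[of _ 2197000]) blast
qed

text \<open>The term \<open>(n + 1) / 2 ^ n\<close> pays for the empty set and the singletons, which
  have no cut and yet are not Hamiltonian.\<close>

lemma (in tournament) prob_hamiltonian_ge:
  assumes deg: "(card (verts G) + 2) div 4 \<le> min_semidegree G"
    and M: "0 < M" "130 * M\<^sup>2 \<le> card (verts G)" and k: "card (verts G) < 2 ^ k"
  shows "1 / 2 - (real (card (verts G)) ^ k * (3 / 4) ^ M + (card (verts G) + 1) / 2 ^ card (verts G))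
    \<le> measure_pmf.prob (pmf_of_set (Pow (verts G))) {S. hamiltonian (G \<restriction> S)}"
proof -
  let ?V = "verts G"
  define n where "n = card ?V"
  have n: "n = Suc (n - 1)" using M unfolding n_def by (cases "card ?V") auto
  then have ne: "?V \<noteq> {}" unfolding n_def by auto
  interpret R: fin_tournament ?V "dominates G" by (rule fin_tournament_dominates)
  interpret R: semidegree_tournament ?V "dominates G" "(n + 2) div 4"
  proof
    show "(n + 2) div 4 \<le> card {u\<in>?V. u \<rightarrow> v}" "(n + 2) div 4 \<le> card {u\<in>?V. v \<rightarrow> u}"
      if "v \<in> ?V" for v
      using deg that le_min_semidegree_iff[OF ne] in_degree_eq_card out_degree_eq_card
      unfolding n_def by metis+
    show "card ?V \<le> 4 * ((n + 2) div 4) + 1" unfolding n_def by linarith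
  qed
  let ?H = "{S\<in>Pow ?V. hamiltonian (G \<restriction> S)}"
  let ?C = "{S. S \<subseteq> ?V \<and> (\<exists>A. R.cut S A)}"
  let ?T = "insert {} ((\<lambda>v. {v}) ` ?V)"
  have "Pow ?V \<subseteq> ?H \<union> (?C \<union> ?T)"
  proof
    fix S assume S: "S \<in> Pow ?V"
    then have "finite S" using R.finite_sub by blast
    show "S \<in> ?H \<union> (?C \<union> ?T)"
    proof (cases "2 \<le> card S")
      case True
      then show ?thesis using hamiltonian_or_cut S by blast
    next
      case False
      then have "card S = 0 \<or> card S = 1" by linarith
      then show ?thesis using \<open>finite S\<close> S by (auto simp: card_1_singleton_iff)
    qed
  qed
  then have "card (Pow ?V) \<le> card (?H \<union> (?C \<union> ?T))" by (intro card_mono) auto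
  also have "\<dots> \<le> card ?H + (card ?C + card ?T)"
    using card_Un_le[of ?H "?C \<union> ?T"] card_Un_le[of ?C ?T] by linarith
  also have "card ?T \<le> n + 1"
    using card_insert_le_m1[of "Suc n" "(\<lambda>v. {v}) ` ?V" "{}"] card_image_le[of ?V "\<lambda>v. {v}"]
    unfolding n_def by simp
  finally have "2 ^ n \<le> card ?H + (card ?C + (n + 1))" by (simp add: card_Pow n_def)
  then have total: "(2::real) ^ n \<le> card ?H + (card ?C + (n + 1))"
    by (metis (mono_tags, lifting) of_nat_add of_nat_le_iff of_nat_numeral of_nat_power)
  have "4 ^ M * card ?C \<le> n ^ k * (3 ^ M * 2 ^ n) + 4 ^ M * 2 ^ (n - 1)"
    using R.card_cuttable_le[OF M k] unfolding n_def .
  then have "real (4 ^ M * card ?C) \<le> real (n ^ k * (3 ^ M * 2 ^ n) + 4 ^ M * 2 ^ (n - 1))"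
    by (simp only: of_nat_le_iff)
  then have "card ?C \<le> real n ^ k * (3 / 4) ^ M * 2 ^ n + 2 ^ (n - 1)"
    by (simp add: power_divide field_simps)
  moreover have "(2::real) ^ n = 2 * 2 ^ (n - 1)" by (subst n) simp
  ultimately have "1 / 2 * 2 ^ n - (real n ^ k * (3 / 4) ^ M * 2 ^ n + (n + 1)) \<le> real (card ?H)"
    using total by linarith
  then have "(1 / 2 * 2 ^ n - (real n ^ k * (3 / 4) ^ M * 2 ^ n + (n + 1))) / 2 ^ n \<le> card ?H / 2 ^ n"
    by (rule divide_right_mono) simp
  also have "(1 / 2 * 2 ^ n - (real n ^ k * (3 / 4) ^ M * 2 ^ n + (n + 1))) / 2 ^ n =
      1 / 2 - (real n ^ k * (3 / 4) ^ M + (n + 1) / 2 ^ n)"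
    by (simp add: diff_divide_distrib add_divide_distrib)
  also have "card ?H / 2 ^ n = measure_pmf.prob (pmf_of_set (Pow ?V)) {S. hamiltonian (G \<restriction> S)}"
    by (subst measure_pmf_of_set) (auto simp: card_Pow n_def Int_def)
  finally show ?thesis unfolding n_def .
qed

theorem theorem1p1:
  shows "\<exists>f :: nat \<Rightarrow> real. f \<longlonglongrightarrow> 0 \<and>
    (\<forall>n. \<forall>T :: ('a, 'b) pre_digraph.
      tournament T \<and> card (verts T) = n \<and> min_semidegree T \<ge> (n + 2) div 4 \<longrightarrow>
      measure_pmf.prob (pmf_of_set (Pow (verts T))) {S. hamiltonian (T \<restriction> S)} \<ge> 1 / 2 - f n)"
proof -
  obtain err N where err: "err \<longlonglongrightarrow> (0::real)"
    and par: "\<And>n. N \<le> n \<Longrightarrow> \<exists>M k. 0 < M \<and> 130 * M\<^sup>2 \<le> n \<and> n < 2 ^ k \<and>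
      real n ^ k * (3 / 4) ^ M \<le> err n"
    using eventually_cut_parameters by blast
  \<comment> \<open>Below \<open>N\<close> the value \<open>1 / 2\<close> makes the claim
    trivial.\<close>
  define f where "f n = (if n < N then 1 / 2 else err n + (real n + 1) / 2 ^ n)" for n
  have "(\<lambda>n. (real n + 1) / 2 ^ n) \<longlonglongrightarrow> 0" by real_asymp
  with err have "(\<lambda>n. err n + (real n + 1) / 2 ^ n) \<longlonglongrightarrow> 0" by (auto intro: tendsto_add_zero)
  moreover have "\<forall>\<^sub>F n in sequentially. err n + (real n + 1) / 2 ^ n = f n"
    unfolding f_def using eventually_ge_at_top[of N] by eventually_elim simp
  ultimately have "f \<longlonglongrightarrow> 0" by (rule Lim_transform_eventually)
  moreover have "1 / 2 - f n \<le> measure_pmf.prob (pmf_of_set (Pow (verts T))) {S. hamiltonian (T \<restriction> S)}"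
    if T: "tournament T" "card (verts T) = n" "(n + 2) div 4 \<le> min_semidegree T"
    for n and T :: "('a, 'b) pre_digraph"
  proof (cases "n < N")
    case True
    then show ?thesis by (simp add: f_def)
  next
    case False
    then obtain M k where h: "0 < M" "130 * M\<^sup>2 \<le> n" "n < 2 ^ k"
      and le: "real n ^ k * (3 / 4) ^ M \<le> err n"
      using par by (meson not_less)
    have "1 / 2 - (real n ^ k * (3 / 4) ^ M + (real n + 1) / 2 ^ n)
        \<le> measure_pmf.prob (pmf_of_set (Pow (verts T))) {S. hamiltonian (T \<restriction> S)}"
      using tournament.prob_hamiltonian_ge[OF T(1), unfolded T(2), OF T(3) h]
      by (simp only: of_nat_add of_nat_1)
    moreover have "f n = err n + (real n + 1) / 2 ^ n" using False by (simp add: f_def)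
    ultimately show ?thesis using le by linarith
  qed
  ultimately show ?thesis by blast
qed

end
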